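(* Let $(M,\mathscr F,\sigma)$ be a sigma-finite measure space and let $(W_A^{(\sigma)})$ be an associated Gaussian process on the probability space $(\Omega,\mathcal B,P)$. Then the integral $$\int_Mf(x)\,dW^{(\sigma)}(x)\in\mathbf L_2(\Omega,\mathcal B,P)$$ exists for all $f\in\mathbf L_2(M,\mathscr F,\sigma)$, and the isometry $$\mathbb E\left[\Big|\int_Mf(x)\,dW^{(\sigma)}(x)\Big|^2\right]=\int_M|f(x)|^2d\sigma(x)$$ holds.
   Context: A Gaussian process associated with the sigma-finite measure space $(M,\mathscr F,\sigma)$ is a family $(W_A^{(\sigma)})$ of real random variables on a probability space, indexed by the sets $A\in\mathscr F$ with $\sigma(A)<\infty$, such that every finite subfamily is jointly Gaussian, $\mathbb E[W_A^{(\sigma)}]=0$, and $\mathbb E[W_A^{(\sigma)}W_B^{(\sigma)}]=\sigma(A\cap B)$. For a simple function $f_s=\sum_{k=1}^nc_k\chi_{A_k}$ with $c_k\in\mathbb R$ and pairwise disjoint $A_k\in\mathscr F$ of finite measure, one sets $\int_Mf_s\,dW^{(\sigma)}=\sum_{k=1}^nc_kW_{A_k}^{(\sigma)}$. For general $f\in\mathbf L_2(M,\mathscr F,\sigma)$ (real-valued), $\int_Mf\,dW^{(\sigma)}$ is the limit in $\mathbf L_2(\Omega,\mathcal B,P)$ of the integrals of simple functions converging to $f$ in $\mathbf L_2(M,\mathscr F,\sigma)$; existence means that this limit exists and does not depend on the choices. *)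

theory Defs
  imports "HOL-Probability.Probability"
begin

definition L2_space :: "'a measure \<Rightarrow> ('a \<Rightarrow> real) set" where
  "L2_space M = {f \<in> borel_measurable M. integrable M (\<lambda>x. \<bar>f x\<bar>\<^sup>2)}"

definition L2_norm :: "'a measure \<Rightarrow> ('a \<Rightarrow> real) \<Rightarrow> real" where
  "L2_norm M f = sqrt (\<integral>x. \<bar>f x\<bar>\<^sup>2 \<partial>M)"

text \<open>Functions rather than almost-everywhere classes are used throughout, so limits are
  unique only up to null sets. Membership in \<open>L2_space\<close> is part of the definition because
  \<open>L2_norm\<close> is meaningless outside of it.\<close>

definition L2_tendsto :: "'a measure \<Rightarrow> (nat \<Rightarrow> 'a \<Rightarrow> real) \<Rightarrow> ('a \<Rightarrow> real) \<Rightarrow> bool" where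
  "L2_tendsto M fs f \<longleftrightarrow> (\<forall>n. fs n \<in> L2_space M) \<and> f \<in> L2_space M \<and>
     (\<lambda>n. L2_norm M (\<lambda>x. fs n x - f x)) \<longlonglongrightarrow> 0"

text \<open>The degenerate (almost surely constant) case is included; it is unavoidable here,
  e.g. for the index set \<open>{}\<close>, or when the covariance matrix of a subfamily is singular.\<close>

definition gaussian_rv :: "'b measure \<Rightarrow> ('b \<Rightarrow> real) \<Rightarrow> bool" where
  "gaussian_rv P X \<longleftrightarrow> X \<in> borel_measurable P \<and>
     ((\<exists>m s. 0 < s \<and> distributed P lborel X (normal_density m s)) \<or>
      (\<exists>m. AE \<omega> in P. X \<omega> = m))"

definition jointly_gaussian :: "'b measure \<Rightarrow> 'i set \<Rightarrow> ('i \<Rightarrow> 'b \<Rightarrow> real) \<Rightarrow> bool" where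
  "jointly_gaussian P J X \<longleftrightarrow> (\<forall>c. gaussian_rv P (\<lambda>\<omega>. \<Sum>j\<in>J. c j * X j \<omega>))"

text \<open>The index family \<open>fmeasurable S\<close> consists of the measurable sets of finite measure. The
  expectations below are finite, since all the \<open>W A\<close> are Gaussian. The values of \<open>W\<close> outside
  the index family are irrelevant.\<close>

definition gaussian_process ::
  "'a measure \<Rightarrow> 'b measure \<Rightarrow> ('a set \<Rightarrow> 'b \<Rightarrow> real) \<Rightarrow> bool" where
  "gaussian_process S P W \<longleftrightarrow>
     (\<forall>A\<in>fmeasurable S. W A \<in> borel_measurable P) \<and>
     (\<forall>J. finite J \<and> J \<subseteq> fmeasurable S \<longrightarrow> jointly_gaussian P J W) \<and>
     (\<forall>A\<in>fmeasurable S. (\<integral>\<omega>. W A \<omega> \<partial>P) = 0) \<and>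
     (\<forall>A\<in>fmeasurable S. \<forall>B\<in>fmeasurable S.
        (\<integral>\<omega>. W A \<omega> * W B \<omega> \<partial>P) = measure S (A \<inter> B))"

text \<open>A relation and not a function: a simple function has many representations, and their
  integrals agree only almost surely.\<close>

definition has_simple_integral ::
  "'a measure \<Rightarrow> ('a set \<Rightarrow> 'b \<Rightarrow> real) \<Rightarrow> ('a \<Rightarrow> real) \<Rightarrow> ('b \<Rightarrow> real) \<Rightarrow> bool" where
  "has_simple_integral S W f Y \<longleftrightarrow>
     (\<exists>(n::nat) c A. (\<forall>k<n. A k \<in> fmeasurable S) \<and> disjoint_family_on A {..<n} \<and>
        (\<forall>x\<in>space S. f x = (\<Sum>k<n. c k * indicator (A k) x)) \<and>
        Y = (\<lambda>\<omega>. \<Sum>k<n. c k * W (A k) \<omega>))"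

definition approximates ::
  "'a measure \<Rightarrow> ('a set \<Rightarrow> 'b \<Rightarrow> real) \<Rightarrow> ('a \<Rightarrow> real) \<Rightarrow>
   (nat \<Rightarrow> 'a \<Rightarrow> real) \<Rightarrow> (nat \<Rightarrow> 'b \<Rightarrow> real) \<Rightarrow> bool" where
  "approximates S W f fs Ys \<longleftrightarrow>
     (\<forall>n. has_simple_integral S W (fs n) (Ys n)) \<and> L2_tendsto S fs f"

text \<open>\<open>X\<close> is a version of the integral of \<open>f\<close>: it is the limit of the integrals of simple
  functions, whichever approximating simple functions and representations of them are chosen.
  The first conjunct keeps the second from holding vacuously.\<close>

definition has_gaussian_integral ::
  "'a measure \<Rightarrow> 'b measure \<Rightarrow> ('a set \<Rightarrow> 'b \<Rightarrow> real) \<Rightarrow> ('a \<Rightarrow> real) \<Rightarrow> ('b \<Rightarrow> real) \<Rightarrow> bool" where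
  "has_gaussian_integral S P W f X \<longleftrightarrow>
     (\<exists>fs Ys. approximates S W f fs Ys) \<and>
     (\<forall>fs Ys. approximates S W f fs Ys \<longrightarrow> L2_tendsto P Ys X)"

end

theory Submission
  imports Defs
begin

text \<open>Because the covariance of \<open>W A\<close> and \<open>W B\<close> is \<open>\<sigma>(A \<inter> B) = \<integral> \<chi>\<^sub>A \<chi>\<^sub>B d\<sigma>\<close>, the integral of simple
  functions preserves inner products, by bilinearity and for any choice of representations. It is
  therefore an isometry from the simple functions into \<open>L\<^sub>2(P)\<close>. Simple functions are dense in
  \<open>L\<^sub>2(\<sigma>)\<close> and \<open>L\<^sub>2(P)\<close> is complete, so the isometry extends uniquely. Of Gaussianity, only the
  existence of second moments matters.\<close>

section \<open>Square-integrable functions\<close>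

lemma L2_space_iff: "f \<in> L2_space M \<longleftrightarrow> f \<in> borel_measurable M \<and> integrable M (\<lambda>x. (f x)\<^sup>2)"
  by (simp add: L2_space_def)

lemma L2_spaceD:
  assumes "f \<in> L2_space M"
  shows L2_space_measurable: "f \<in> borel_measurable M"
    and L2_space_integrable: "integrable M (\<lambda>x. (f x)\<^sup>2)"
  using assms by (auto simp: L2_space_iff)

lemma L2_norm_nonneg [simp]: "0 \<le> L2_norm M f"
  by (simp add: L2_norm_def)

lemma L2_norm_power2: "(L2_norm M f)\<^sup>2 = (\<integral>x. (f x)\<^sup>2 \<partial>M)"
  by (simp add: L2_norm_def)

lemma L2_norm_minus_commute: "L2_norm M (\<lambda>x. f x - g x) = L2_norm M (\<lambda>x. g x - f x)"
  by (simp add: L2_norm_def abs_minus_commute)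

lemma L2_norm_le_iff: "0 \<le> c \<Longrightarrow> L2_norm M f \<le> c \<longleftrightarrow> (\<integral>x. (f x)\<^sup>2 \<partial>M) \<le> c\<^sup>2"
  by (metis L2_norm_nonneg L2_norm_power2 power2_le_iff_abs_le abs_of_nonneg)

text \<open>The pointwise bound \<open>\<bar>a * b\<bar> \<le> a\<^sup>2 + b\<^sup>2\<close>
  dominates the product by an integrable function; it also yields closure of \<open>L2_space\<close>
  under sums and differences, through the cross terms.\<close>

lemma integrable_mult_L2:
  assumes f: "f \<in> L2_space M" and g: "g \<in> L2_space M"
  shows "integrable M (\<lambda>x. f x * g x)"
proof (rule Bochner_Integration.integrable_bound)
  show "integrable M (\<lambda>x. (f x)\<^sup>2 + (g x)\<^sup>2)"
    using f g by (simp add: L2_space_iff)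
  show "(\<lambda>x. f x * g x) \<in> borel_measurable M"
    using f g by (auto simp: L2_space_iff)
  have "\<bar>a * b\<bar> \<le> a\<^sup>2 + b\<^sup>2" for a b :: real
    using sum_squares_bound[of "\<bar>a\<bar>" "\<bar>b\<bar>"] mult_nonneg_nonneg[of "\<bar>a\<bar>" "\<bar>b\<bar>"]
    by (simp only: power2_abs abs_mult) linarith
  then show "AE x in M. norm (f x * g x) \<le> norm ((f x)\<^sup>2 + (g x)\<^sup>2)"
    by (simp add: abs_mult)
qed

lemma L2_space_scale:
  assumes "f \<in> L2_space M"
  shows "(\<lambda>x. c * f x) \<in> L2_space M"
  using assms by (auto simp: L2_space_iff power_mult_distrib)

lemma L2_space_add:
  assumes "f \<in> L2_space M" "g \<in> L2_space M"
  shows "(\<lambda>x. f x + g x) \<in> L2_space M"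
  using assms integrable_mult_L2[OF assms]
  by (auto simp: L2_space_iff power2_sum mult.assoc)

lemma L2_space_diff:
  assumes "f \<in> L2_space M" "g \<in> L2_space M"
  shows "(\<lambda>x. f x - g x) \<in> L2_space M"
  using assms integrable_mult_L2[OF assms]
  by (auto simp: L2_space_iff power2_diff mult.assoc)

lemma L2_space_sum:
  assumes "\<And>i. i \<in> I \<Longrightarrow> f i \<in> L2_space M"
  shows "(\<lambda>x. \<Sum>i\<in>I. f i x) \<in> L2_space M"
  using assms
proof (induction I rule: infinite_finite_induct)
  case (insert i I)
  then show ?case using L2_space_add[of "f i" M "\<lambda>x. \<Sum>i\<in>I. f i x"] by simp
\<comment> \<open>A sum over an infinite index set is 0 by convention, so this case and the empty
  one both concern the zero function.\<close>
qed (simp_all add: L2_space_iff)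

lemma L2_space_cong:
  assumes "f \<in> L2_space M" "\<And>x. x \<in> space M \<Longrightarrow> g x = f x"
  shows "g \<in> L2_space M"
  using assms by (simp add: L2_space_iff cong: measurable_cong Bochner_Integration.integrable_cong)

text \<open>The squares on the right are written as products so that identities between inner
  products can rewrite all three terms.\<close>

lemma integral_power2_diff_L2:
  assumes f: "f \<in> L2_space M" and g: "g \<in> L2_space M"
  shows "(\<integral>x. (f x - g x)\<^sup>2 \<partial>M) = (\<integral>x. f x * f x \<partial>M) - 2 * (\<integral>x. f x * g x \<partial>M) + (\<integral>x. g x * g x \<partial>M)"
proof -
  note [simp] = integrable_mult_L2[OF f g] integrable_mult_L2[OF f f] integrable_mult_L2[OF g g]
  have "(\<integral>x. (f x - g x)\<^sup>2 \<partial>M) = (\<integral>x. f x * f x - 2 * (f x * g x) + g x * g x \<partial>M)"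
    by (intro Bochner_Integration.integral_cong refl) (simp add: power2_eq_square algebra_simps)
  then show ?thesis by simp
qed

text \<open>With \<open>p > \<parallel>f\<parallel>\<close> and \<open>q > \<parallel>g\<parallel>\<close>, integrating \<open>2 f g \<le> (q / p) f\<^sup>2 + (p / q) g\<^sup>2\<close> bounds the
  cross term by \<open>2 p q\<close>, without a case distinction for vanishing norms.\<close>

lemma L2_norm_triangle:
  assumes f: "f \<in> L2_space M" and g: "g \<in> L2_space M"
  shows "L2_norm M (\<lambda>x. f x + g x) \<le> L2_norm M f + L2_norm M g"
proof (rule field_le_epsilon)
  fix e :: real assume "0 < e"
  define p q where "p = L2_norm M f + e / 2" and "q = L2_norm M g + e / 2"
  have pq: "0 < p" "0 < q" "L2_norm M f \<le> p" "L2_norm M g \<le> q"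
    using \<open>0 < e\<close> by (simp_all add: p_def q_def add_nonneg_pos)
  note fg = L2_space_integrable[OF f] L2_space_integrable[OF g]
  have young: "(a + b)\<^sup>2 \<le> (1 + q / p) * a\<^sup>2 + (1 + p / q) * b\<^sup>2" for a b :: real
  proof -
    have "0 \<le> (q * a - p * b)\<^sup>2 / (p * q)"
      using pq by simp
    also have "\<dots> = (1 + q / p) * a\<^sup>2 + (1 + p / q) * b\<^sup>2 - (a + b)\<^sup>2"
      using pq by (simp add: field_simps power2_eq_square)
    finally show ?thesis by simp
  qed
  have "(\<integral>x. (f x + g x)\<^sup>2 \<partial>M) \<le> (\<integral>x. (1 + q / p) * (f x)\<^sup>2 + (1 + p / q) * (g x)\<^sup>2 \<partial>M)"
    using L2_space_integrable[OF L2_space_add[OF f g]] fg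
    by (intro integral_mono young) auto
  also have "\<dots> = (1 + q / p) * (L2_norm M f)\<^sup>2 + (1 + p / q) * (L2_norm M g)\<^sup>2"
    using fg by (simp add: L2_norm_power2)
  also have "\<dots> \<le> (1 + q / p) * p\<^sup>2 + (1 + p / q) * q\<^sup>2"
    using pq by (intro add_mono mult_left_mono power_mono) auto
  also have "\<dots> = (p + q)\<^sup>2"
    using pq by (simp add: field_simps power2_eq_square)
  finally have "L2_norm M (\<lambda>x. f x + g x) \<le> p + q"
    using pq by (subst L2_norm_le_iff) auto
  then show "L2_norm M (\<lambda>x. f x + g x) \<le> L2_norm M f + L2_norm M g + e"
    by (simp add: p_def q_def)
qed

lemma L2_norm_diff_triangle:
  assumes "f \<in> L2_space M" "g \<in> L2_space M" "h \<in> L2_space M"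
  shows "L2_norm M (\<lambda>x. f x - h x) \<le> L2_norm M (\<lambda>x. f x - g x) + L2_norm M (\<lambda>x. g x - h x)"
  using L2_norm_triangle[OF L2_space_diff L2_space_diff, of f M g g h] assms by simp

lemma L2_norm_reverse_triangle:
  assumes f: "f \<in> L2_space M" and g: "g \<in> L2_space M"
  shows "\<bar>L2_norm M f - L2_norm M g\<bar> \<le> L2_norm M (\<lambda>x. f x - g x)"
  using L2_norm_triangle[OF L2_space_diff[OF f g] g] L2_norm_triangle[OF L2_space_diff[OF g f] f]
  by (simp add: L2_norm_minus_commute[of M g f])

section \<open>Convergence in the seminorm \<open>L2_norm\<close>, with limits unique almost
  everywhere\<close>

lemma AE_eq_if_L2_norm_diff_0:
  assumes f: "f \<in> L2_space M" and g: "g \<in> L2_space M" and 0: "L2_norm M (\<lambda>x. f x - g x) = 0"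
  shows "AE x in M. f x = g x"
proof -
  have "(\<integral>x. (f x - g x)\<^sup>2 \<partial>M) = 0"
    using 0 L2_norm_power2[of M "\<lambda>x. f x - g x"] by simp
  \<comment> \<open>A nonnegative integrable function with integral 0 vanishes almost everywhere.
    Integrability rules out the value 0 that the Bochner integral takes by default.\<close>
  then have "AE x in M. (f x - g x)\<^sup>2 = 0"
    using L2_space_integrable[OF L2_space_diff[OF f g]]
    by (subst (asm) integral_nonneg_eq_0_iff_AE) auto
  then show ?thesis by simp
qed

text \<open>Continuity of the norm, from the reverse triangle inequality. It carries the norm
  identity from simple functions to their limits.\<close>

lemma L2_tendsto_norm:
  assumes "L2_tendsto M fs f"
  shows "(\<lambda>n. L2_norm M (fs n)) \<longlonglongrightarrow> L2_norm M f"
proof (rule LIM_zero_cancel, rule tendsto_rabs_zero_cancel)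
  have fs: "\<And>n. fs n \<in> L2_space M" "f \<in> L2_space M" "(\<lambda>n. L2_norm M (\<lambda>x. fs n x - f x)) \<longlonglongrightarrow> 0"
    using assms by (auto simp: L2_tendsto_def)
  show "(\<lambda>n. \<bar>L2_norm M (fs n) - L2_norm M f\<bar>) \<longlonglongrightarrow> 0"
    by (rule tendsto_sandwich[OF _ _ tendsto_const fs(3)])
      (auto intro!: always_eventually L2_norm_reverse_triangle fs)
qed

lemma L2_tendsto_unique:
  assumes "L2_tendsto M fs f" "L2_tendsto M fs g"
  shows "AE x in M. f x = g x"
proof (rule AE_eq_if_L2_norm_diff_0)
  have fs: "\<And>n. fs n \<in> L2_space M"
    and f: "f \<in> L2_space M" "(\<lambda>n. L2_norm M (\<lambda>x. fs n x - f x)) \<longlonglongrightarrow> 0"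
    and g: "g \<in> L2_space M" "(\<lambda>n. L2_norm M (\<lambda>x. fs n x - g x)) \<longlonglongrightarrow> 0"
    using assms by (auto simp: L2_tendsto_def)
  show "f \<in> L2_space M" "g \<in> L2_space M" by fact+
  have "L2_norm M (\<lambda>x. f x - g x) \<le> L2_norm M (\<lambda>x. fs n x - f x) + L2_norm M (\<lambda>x. fs n x - g x)" for n
    using L2_norm_diff_triangle[OF f(1) fs[of n] g(1)] by (simp add: L2_norm_minus_commute[of M f])
  then have "L2_norm M (\<lambda>x. f x - g x) \<le> 0"
    using LIMSEQ_le_const[OF tendsto_add[OF f(2) g(2)]] by auto
  then show "L2_norm M (\<lambda>x. f x - g x) = 0"
    using L2_norm_nonneg[of M "\<lambda>x. f x - g x"] by linarith
qed

text \<open>Used to show that the limit of the integrals is the same for every approximating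
  sequence.\<close>

lemma L2_tendsto_if_diff_tendsto_0:
  assumes f: "L2_tendsto M fs f" and g: "\<And>n. gs n \<in> L2_space M"
    and diff: "(\<lambda>n. L2_norm M (\<lambda>x. gs n x - fs n x)) \<longlonglongrightarrow> 0"
  shows "L2_tendsto M gs f"
proof -
  have fs: "\<And>n. fs n \<in> L2_space M" "f \<in> L2_space M" "(\<lambda>n. L2_norm M (\<lambda>x. fs n x - f x)) \<longlonglongrightarrow> 0"
    using f by (auto simp: L2_tendsto_def)
  have "(\<lambda>n. L2_norm M (\<lambda>x. gs n x - f x)) \<longlonglongrightarrow> 0"
  proof (rule tendsto_sandwich[OF _ _ tendsto_const])
    show "(\<lambda>n. L2_norm M (\<lambda>x. gs n x - fs n x) + L2_norm M (\<lambda>x. fs n x - f x)) \<longlonglongrightarrow> 0"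
      using tendsto_add[OF diff fs(3)] by simp
  qed (auto intro!: always_eventually L2_norm_diff_triangle fs g)
  with fs(2) g show ?thesis by (simp add: L2_tendsto_def)
qed

text \<open>Riesz--Fischer. Along a subsequence with \<open>\<parallel>\<Delta>\<^sub>k\<parallel> \<le> 2\<^sup>-\<^sup>k\<close> the series \<open>\<Sum> 2\<^sup>k \<Delta>\<^sub>k\<^sup>2\<close> has a finite
  integral, hence is finite almost everywhere; as \<open>\<bar>\<Delta>\<^sub>k\<bar> \<le> 2\<^sup>k \<Delta>\<^sub>k\<^sup>2 + 2\<^sup>-\<^sup>k\<close>, the subsequence
  converges almost everywhere. Fatou's lemma turns this into convergence in norm of the whole
  sequence.\<close>

lemma AE_summable_if_fast_L2:
  assumes d: "\<And>k. d k \<in> L2_space M" and bound: "\<And>k. L2_norm M (d k) \<le> (1/2) ^ k"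
  shows "AE x in M. summable (\<lambda>k. d k x)"
proof -
  have [measurable]: "d k \<in> borel_measurable M" for k
    using d by (rule L2_space_measurable)
  have "(\<integral>\<^sup>+x. ennreal (2 ^ k * (d k x)\<^sup>2) \<partial>M) \<le> ennreal ((1/2) ^ k)" for k
  proof -
    have "(\<integral>\<^sup>+x. ennreal (2 ^ k * (d k x)\<^sup>2) \<partial>M) = ennreal (\<integral>x. 2 ^ k * (d k x)\<^sup>2 \<partial>M)"
      using L2_space_integrable[OF d[of k]] by (intro nn_integral_eq_integral) auto
    also have "(\<integral>x. 2 ^ k * (d k x)\<^sup>2 \<partial>M) = 2 ^ k * (L2_norm M (d k))\<^sup>2"
      by (simp add: L2_norm_power2)
    also have "\<dots> \<le> 2 ^ k * ((1/2) ^ k)\<^sup>2"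
      using bound by (intro mult_left_mono power_mono) auto
    also have "\<dots> = (1/2) ^ k"
      by (simp add: power2_eq_square power_one_over)
    finally show ?thesis by (simp add: ennreal_leI)
  qed
  then have "(\<Sum>k. \<integral>\<^sup>+x. ennreal (2 ^ k * (d k x)\<^sup>2) \<partial>M) \<le> (\<Sum>k. ennreal ((1/2) ^ k))"
    by (intro suminf_le) auto
  also have "\<dots> < top"
    by (subst less_top[symmetric], rule ennreal_suminf_neq_top) (auto intro!: summable_geometric)
  finally have "(\<integral>\<^sup>+x. (\<Sum>k. ennreal (2 ^ k * (d k x)\<^sup>2)) \<partial>M) \<noteq> \<infinity>"
    by (subst nn_integral_suminf) auto
  then have "AE x in M. (\<Sum>k. ennreal (2 ^ k * (d k x)\<^sup>2)) \<noteq> \<infinity>"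
    by (intro nn_integral_PInf_AE) auto
  then show ?thesis
  proof eventually_elim
    case (elim x)
    then have "summable (\<lambda>k. 2 ^ k * (d k x)\<^sup>2)"
      by (intro summable_suminf_not_top) auto
    then have "summable (\<lambda>k. 2 ^ k * (d k x)\<^sup>2 + (1/2) ^ k)"
      by (intro summable_add summable_geometric) auto
    moreover have "norm (d k x) \<le> 2 ^ k * (d k x)\<^sup>2 + (1/2) ^ k" for k
    proof -
      have am_gm: "\<bar>a\<bar> \<le> c * a\<^sup>2 + 1 / c" if "0 < c" for a c :: real
      proof -
        have "0 \<le> (c * \<bar>a\<bar> - 1)\<^sup>2 / c + \<bar>a\<bar>" using that by simp
        also have "\<dots> = c * a\<^sup>2 + 1 / c - \<bar>a\<bar>"
          using that by (simp add: field_simps power2_eq_square)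
        finally show ?thesis by simp
      qed
      show ?thesis using am_gm[of "2 ^ k" "d k x"] by (simp add: power_one_over)
    qed
    ultimately show ?case by (rule summable_comparison_test'[where N = 0])
  qed
qed

text \<open>Fatou's lemma applied to \<open>(f n x - h x)\<^sup>2\<close>. The reference function
  \<open>h\<close> will be a member of the Cauchy sequence itself, so that a bound on its tail
  passes to the limit.\<close>

lemma L2_limit_of_AE_limit:
  assumes f: "\<And>n. f n \<in> L2_space M" and g [measurable]: "g \<in> borel_measurable M"
    and h: "h \<in> L2_space M" and lim: "AE x in M. (\<lambda>n. f n x) \<longlonglongrightarrow> g x"
    and bound: "eventually (\<lambda>n. L2_norm M (\<lambda>x. f n x - h x) \<le> c) sequentially" and "0 \<le> c"
  shows "g \<in> L2_space M" "L2_norm M (\<lambda>x. g x - h x) \<le> c"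
proof -
  have [measurable]: "f n \<in> borel_measurable M" "h \<in> borel_measurable M" for n
    using f h by (simp_all add: L2_space_measurable)
  have fh: "(\<integral>\<^sup>+x. ennreal ((f n x - h x)\<^sup>2) \<partial>M) = ennreal ((L2_norm M (\<lambda>x. f n x - h x))\<^sup>2)" for n
    unfolding L2_norm_power2 using L2_space_integrable[OF L2_space_diff[OF f h]]
    by (intro nn_integral_eq_integral) auto
  have "(\<integral>\<^sup>+x. ennreal ((g x - h x)\<^sup>2) \<partial>M) = (\<integral>\<^sup>+x. liminf (\<lambda>n. ennreal ((f n x - h x)\<^sup>2)) \<partial>M)"
  proof (rule nn_integral_cong_AE, use lim in eventually_elim)
    case (elim x)
    then have "(\<lambda>n. ennreal ((f n x - h x)\<^sup>2)) \<longlonglongrightarrow> ennreal ((g x - h x)\<^sup>2)"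
      by (intro tendsto_intros)
    then show ?case by (rule lim_imp_Liminf[OF sequentially_bot, symmetric])
  qed
  also have "\<dots> \<le> liminf (\<lambda>n. \<integral>\<^sup>+x. ennreal ((f n x - h x)\<^sup>2) \<partial>M)"
    by (rule nn_integral_liminf) auto
  also have "\<dots> \<le> liminf (\<lambda>n. ennreal (c\<^sup>2))"
    unfolding fh using bound
    by (intro Liminf_mono, eventually_elim) (auto intro!: ennreal_leI power_mono)
  also have "\<dots> = ennreal (c\<^sup>2)" by (simp add: Liminf_const)
  finally have le: "(\<integral>\<^sup>+x. ennreal ((g x - h x)\<^sup>2) \<partial>M) \<le> ennreal (c\<^sup>2)" .
  \<comment> \<open>The bound on the nonnegative integral comes first: it gives integrability, and
    only then does the real-valued integral carry the same information.\<close>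
  then have int: "integrable M (\<lambda>x. (g x - h x)\<^sup>2)"
    by (intro integrableI_bounded) (auto simp: le_less_trans[OF _ ennreal_less_top])
  then have gh: "(\<lambda>x. g x - h x) \<in> L2_space M"
    by (simp add: L2_space_iff)
  from L2_space_add[OF this h] show "g \<in> L2_space M" by simp
  have "(\<integral>x. (g x - h x)\<^sup>2 \<partial>M) \<le> c\<^sup>2"
    using le nn_integral_eq_integral[OF int] by (simp add: ennreal_le_iff)
  then show "L2_norm M (\<lambda>x. g x - h x) \<le> c"
    using \<open>0 \<le> c\<close> by (simp add: L2_norm_le_iff)
qed

lemma L2_complete:
  assumes f: "\<And>n. f n \<in> L2_space M"
    and Cauchy: "\<And>e. 0 < e \<Longrightarrow> \<exists>N. \<forall>m\<ge>N. \<forall>n\<ge>N. L2_norm M (\<lambda>x. f m x - f n x) < e"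
  shows "\<exists>g. L2_tendsto M f g"
proof -
  have "\<exists>N. \<forall>k. (\<forall>m\<ge>N k. \<forall>n\<ge>N k. L2_norm M (\<lambda>x. f m x - f n x) < (1/2) ^ k)"
    by (intro choice allI Cauchy) simp
  then obtain N where N: "\<And>k m n. N k \<le> m \<Longrightarrow> N k \<le> n \<Longrightarrow> L2_norm M (\<lambda>x. f m x - f n x) < (1/2) ^ k"
    by blast
  \<comment> \<open>The partial sums of \<open>N\<close> make \<open>r\<close> monotone with
    \<open>N k \<le> r k\<close>; the summand \<open>k\<close> forces \<open>r\<close> to infinity,
    so that \<open>r k\<close> eventually passes every threshold.\<close>
  define r where "r k = k + (\<Sum>i\<le>k. N i)" for k
  have r: "N k \<le> r k" "k \<le> r k" "r k \<le> r (Suc k)" for k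
    using member_le_sum[of k "{..k}" N] by (auto simp: r_def)
  have "AE x in M. summable (\<lambda>k. f (r (Suc k)) x - f (r k) x)"
  proof (rule AE_summable_if_fast_L2)
    show "(\<lambda>x. f (r (Suc k)) x - f (r k) x) \<in> L2_space M" for k
      by (intro L2_space_diff f)
    show "L2_norm M (\<lambda>x. f (r (Suc k)) x - f (r k) x) \<le> (1/2) ^ k" for k
      by (rule less_imp_le[OF N]) (use r[of k] in linarith)+
  qed
  then have lim: "AE x in M. (\<lambda>k. f (r k) x) \<longlonglongrightarrow> lim (\<lambda>k. f (r k) x)"
  proof eventually_elim
    case (elim x)
    then have "convergent (\<lambda>k. f (r k) x - f (r 0) x)"
      by (simp add: summable_iff_convergent sum_lessThan_telescope[of "\<lambda>k. f (r k) x"])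
    then show ?case
      by (simp add: convergent_diff_const_right_iff convergent_LIMSEQ_iff)
  qed
  \<comment> \<open>Where the subsequence diverges, \<open>lim\<close> has one fixed unspecified
    value, so \<open>g\<close> is measurable on the whole space and is the limit outside a null
    set.\<close>
  define g where "g x = lim (\<lambda>k. f (r k) x)" for x
  have [measurable]: "f n \<in> borel_measurable M" for n
    using f by (rule L2_space_measurable)
  have g: "g \<in> borel_measurable M"
    unfolding g_def by measurable
  \<comment> \<open>Here \<open>n\<close> stays fixed while \<open>r k\<close> tends to infinity.
    The strict Cauchy bound becomes a weak one in the limit, which is why convergence is proved
    below from \<open>e / 2\<close>.\<close>
  have norm: "g \<in> L2_space M \<and> L2_norm M (\<lambda>x. g x - f n x) \<le> e"
    if "\<forall>m\<ge>K. \<forall>n\<ge>K. L2_norm M (\<lambda>x. f m x - f n x) < e" "K \<le> n" "0 < e" for K n e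
  proof -
    have "L2_norm M (\<lambda>x. f (r k) x - f n x) \<le> e" if "K \<le> k" for k
      using \<open>K \<le> n\<close> \<open>\<forall>m\<ge>K. _\<close> order_trans[OF that r(2)] by (auto intro: less_imp_le)
    then have "eventually (\<lambda>k. L2_norm M (\<lambda>x. f (r k) x - f n x) \<le> e) sequentially"
      by (auto simp: eventually_sequentially)
    from L2_limit_of_AE_limit[OF f g f lim[folded g_def] this] \<open>0 < e\<close> show ?thesis by auto
  qed
  have "(\<lambda>n. L2_norm M (\<lambda>x. f n x - g x)) \<longlonglongrightarrow> 0"
  proof (rule LIMSEQ_I)
    fix e :: real assume "0 < e"
    then obtain K where K: "\<forall>m\<ge>K. \<forall>n\<ge>K. L2_norm M (\<lambda>x. f m x - f n x) < e / 2"
      using Cauchy[of "e / 2"] by auto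
    show "\<exists>K. \<forall>n\<ge>K. norm (L2_norm M (\<lambda>x. f n x - g x) - 0) < e"
    proof (intro exI allI impI)
      fix n assume "K \<le> n"
      then show "norm (L2_norm M (\<lambda>x. f n x - g x) - 0) < e"
        using norm[OF K \<open>K \<le> n\<close>] \<open>0 < e\<close> by (auto simp: L2_norm_minus_commute[of M "f n"])
    qed
  qed
  moreover have "g \<in> L2_space M"
    using Cauchy[of 1] norm[of _ 1] by auto
  ultimately show ?thesis
    using f by (auto simp: L2_tendsto_def)
qed

section \<open>Integrals of simple functions\<close>

text \<open>In the nondegenerate case the centred second moment of the normal density is finite, and
  the mean is added back as a constant, which is square-integrable on a probability space. The
  degenerate case is a constant up to a null set.\<close>

lemma (in prob_space) gaussian_rv_L2:
  assumes "gaussian_rv M X"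
  shows "X \<in> L2_space M"
proof -
  have X [measurable]: "X \<in> borel_measurable M"
    using assms by (simp add: gaussian_rv_def)
  consider m s where "0 < s" "distributed M lborel X (normal_density m s)"
    | m where "AE \<omega> in M. X \<omega> = m"
    using assms by (auto simp: gaussian_rv_def)
  then show ?thesis
  proof cases
    case (1 m s)
    have "integrable lborel (\<lambda>x. normal_density m s x * (x - m)\<^sup>2)"
      using 1(1) by (rule integrable_normal_moment)
    then have "integrable M (\<lambda>\<omega>. (X \<omega> - m)\<^sup>2)"
      using 1 by (subst (asm) distributed_integrable[OF 1(2)]) auto
    then have "(\<lambda>\<omega>. X \<omega> - m) \<in> L2_space M"
      by (simp add: L2_space_iff)
    from L2_space_add[OF this, of "\<lambda>_. m"] show ?thesis
      by (simp add: L2_space_iff)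
  next
    case (2 m)
    then have "integrable M (\<lambda>\<omega>. (X \<omega>)\<^sup>2) \<longleftrightarrow> integrable M (\<lambda>\<omega>. m\<^sup>2)"
      by (intro integrable_cong_AE) auto
    then show ?thesis by (simp add: L2_space_iff)
  qed
qed

lemma gaussian_process_L2:
  assumes "prob_space P" "gaussian_process S P W" "A \<in> fmeasurable S"
  shows "W A \<in> L2_space P"
proof -
  interpret prob_space P by fact
  have "jointly_gaussian P {A} W"
    using assms by (simp add: gaussian_process_def)
  \<comment> \<open>The linear combination over the one-element family \<open>{A}\<close> with
    coefficient 1 is \<open>W A\<close> itself.\<close>
  then have "gaussian_rv P (\<lambda>\<omega>. \<Sum>j\<in>{A}. 1 * W j \<omega>)"
    unfolding jointly_gaussian_def by (rule spec)
  then show ?thesis by (intro gaussian_rv_L2) simp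
qed

lemma indicator_L2:
  assumes "A \<in> fmeasurable S"
  shows "(indicator A :: 'a \<Rightarrow> real) \<in> L2_space S"
proof -
  have "(\<lambda>x. (indicator A x)\<^sup>2) = (indicator A :: 'a \<Rightarrow> real)"
    by (auto simp: indicator_def)
  with assms show ?thesis by (auto simp: L2_space_iff fmeasurable_def)
qed

lemma has_simple_integral_L2:
  assumes "prob_space P" "gaussian_process S P W" "has_simple_integral S W f Y"
  shows "f \<in> L2_space S" "Y \<in> L2_space P"
proof -
  from assms(3) obtain n :: nat and c A where A: "\<And>k. k < n \<Longrightarrow> A k \<in> fmeasurable S"
    and f: "\<And>x. x \<in> space S \<Longrightarrow> f x = (\<Sum>k<n. c k * indicator (A k) x)"
    and Y: "Y = (\<lambda>\<omega>. \<Sum>k<n. c k * W (A k) \<omega>)"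
    unfolding has_simple_integral_def by blast
  show "Y \<in> L2_space P"
    unfolding Y using A by (intro L2_space_sum L2_space_scale gaussian_process_L2[OF assms(1,2)]) auto
  have "(\<lambda>x. \<Sum>k<n. c k * indicator (A k) x) \<in> L2_space S"
    using A by (intro L2_space_sum L2_space_scale indicator_L2) auto
  then show "f \<in> L2_space S" by (rule L2_space_cong) (rule f)
qed

text \<open>Expanding both double sums reduces the claim to one pair of sets, where it is the
  covariance formula. Two unrelated representations are thus compared directly.\<close>

lemma has_simple_integral_inner:
  assumes P: "prob_space P" and W: "gaussian_process S P W"
    and fY: "has_simple_integral S W f Y" and gZ: "has_simple_integral S W g Z"
  shows "(\<integral>\<omega>. Y \<omega> * Z \<omega> \<partial>P) = (\<integral>x. f x * g x \<partial>S)"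
proof -
  from fY obtain n :: nat and c A where A: "\<And>k. k < n \<Longrightarrow> A k \<in> fmeasurable S"
    and f: "\<And>x. x \<in> space S \<Longrightarrow> f x = (\<Sum>k<n. c k * indicator (A k) x)"
    and Y: "Y = (\<lambda>\<omega>. \<Sum>k<n. c k * W (A k) \<omega>)"
    unfolding has_simple_integral_def by blast
  from gZ obtain m :: nat and d B where B: "\<And>k. k < m \<Longrightarrow> B k \<in> fmeasurable S"
    and g: "\<And>x. x \<in> space S \<Longrightarrow> g x = (\<Sum>k<m. d k * indicator (B k) x)"
    and Z: "Z = (\<lambda>\<omega>. \<Sum>k<m. d k * W (B k) \<omega>)"
    unfolding has_simple_integral_def by blast
  have WW: "integrable P (\<lambda>\<omega>. W (A i) \<omega> * W (B j) \<omega>)" if "i < n" "j < m" for i j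
    using that A B by (intro integrable_mult_L2 gaussian_process_L2[OF P W]) auto
  have II: "integrable S (\<lambda>x. indicator (A i) x * indicator (B j) x :: real)" if "i < n" "j < m" for i j
    using that A B by (intro integrable_mult_L2 indicator_L2) auto
  have cov: "(\<integral>\<omega>. W (A i) \<omega> * W (B j) \<omega> \<partial>P) = (\<integral>x. indicator (A i) x * indicator (B j) x \<partial>S)"
    if "i < n" "j < m" for i j
  proof -
    \<comment> \<open>The integral of an indicator is the measure of the set cut down to
      \<open>space S\<close>; measurable sets already lie inside it.\<close>
    have "A i \<inter> B j \<inter> space S = A i \<inter> B j"
      using A[OF that(1)] by (auto simp: fmeasurable_def dest: sets.sets_into_space)
    then show ?thesis
      using A[OF that(1)] B[OF that(2)] W
      by (simp add: gaussian_process_def flip: indicator_inter_arith)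
  qed
  have "(\<integral>\<omega>. Y \<omega> * Z \<omega> \<partial>P) = (\<integral>\<omega>. (\<Sum>i<n. \<Sum>j<m. c i * d j * (W (A i) \<omega> * W (B j) \<omega>)) \<partial>P)"
    by (simp only: Y Z sum_product mult_ac)
  also have "\<dots> = (\<Sum>i<n. \<Sum>j<m. c i * d j * (\<integral>\<omega>. W (A i) \<omega> * W (B j) \<omega> \<partial>P))"
    using WW by (subst Bochner_Integration.integral_sum) (auto intro!: sum.cong)
  also have "\<dots> = (\<Sum>i<n. \<Sum>j<m. c i * d j * (\<integral>x. indicator (A i) x * indicator (B j) x \<partial>S))"
    by (simp add: cov)
  also have "\<dots> = (\<integral>x. (\<Sum>i<n. \<Sum>j<m. c i * d j * (indicator (A i) x * indicator (B j) x)) \<partial>S)"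
    using II by (subst Bochner_Integration.integral_sum) (auto intro!: sum.cong)
  also have "\<dots> = (\<integral>x. f x * g x \<partial>S)"
    by (intro Bochner_Integration.integral_cong refl) (simp only: f g sum_product mult_ac)
  finally show ?thesis .
qed

text \<open>Expanding the square leaves three inner products, each preserved. This avoids building a
  disjoint representation of \<open>f - g\<close>; for \<open>f = g\<close> it shows that two
  representations have almost surely equal integrals.\<close>

lemma has_simple_integral_isometry:
  assumes P: "prob_space P" and W: "gaussian_process S P W"
    and fY: "has_simple_integral S W f Y" and gZ: "has_simple_integral S W g Z"
  shows "L2_norm P (\<lambda>\<omega>. Y \<omega> - Z \<omega>) = L2_norm S (\<lambda>x. f x - g x)"
proof -
  note inner = has_simple_integral_inner[OF P W]
  note L2 = has_simple_integral_L2[OF P W]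
  have "(\<integral>\<omega>. (Y \<omega> - Z \<omega>)\<^sup>2 \<partial>P) = (\<integral>x. (f x - g x)\<^sup>2 \<partial>S)"
    by (simp add: integral_power2_diff_L2 L2[OF fY] L2[OF gZ] inner[OF fY fY] inner[OF fY gZ] inner[OF gZ gZ])
  then show ?thesis by (simp add: L2_norm_def)
qed

section \<open>Density of the simple functions in \<open>L2_space S\<close>\<close>

lemma simple_function_has_simple_integral:
  fixes f :: "'a \<Rightarrow> real"
  assumes f: "simple_function S f" and int: "integrable S (\<lambda>x. (f x)\<^sup>2)"
  shows "\<exists>Y. has_simple_integral S W f Y"
proof -
  have [measurable]: "f \<in> borel_measurable S"
    using f by (rule borel_measurable_simple_function)
  \<comment> \<open>The representation uses the level sets of the nonzero values. The level set of 0
    is left out because its measure may be infinite.\<close>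
  define V where "V = f ` space S - {0}"
  have "finite V" using f by (simp add: V_def simple_function_def)
  then obtain c where c: "bij_betw c {0..<card V} V"
    using ex_bij_betw_nat_finite by blast
  define A where "A k = f -` {c k} \<inter> space S" for k
  have inj: "inj_on c {..<card V}" and img: "c ` {..<card V} = V"
    using c by (auto simp: bij_betw_def atLeast0LessThan)
  have "A k \<in> fmeasurable S" if "k < card V" for k
  proof -
    have "c k \<noteq> 0" using img that by (auto simp: V_def)
    have [measurable]: "A k \<in> sets S" unfolding A_def by measurable
    \<comment> \<open>Chebyshev's argument: on \<open>A k\<close> the quotient
      \<open>(f x)\<^sup>2 / (c k)\<^sup>2\<close> equals 1, so it dominates the indicator.\<close>
    have "integrable S (indicator (A k) :: 'a \<Rightarrow> real)"
    proof (rule Bochner_Integration.integrable_bound)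
      show "integrable S (\<lambda>x. (f x)\<^sup>2 / (c k)\<^sup>2)" using int by simp
      show "AE x in S. norm (indicator (A k) x :: real) \<le> norm ((f x)\<^sup>2 / (c k)\<^sup>2)"
        using \<open>c k \<noteq> 0\<close> by (auto simp: A_def indicator_def)
    qed simp
    then show ?thesis
      by (simp add: integrable_indicator_iff fmeasurable_def)
  qed
  moreover have "disjoint_family_on A {..<card V}"
    using inj by (auto simp: disjoint_family_on_def A_def inj_on_def)
  moreover have "f x = (\<Sum>k<card V. c k * indicator (A k) x)" if "x \<in> space S" for x
  proof -
    \<comment> \<open>Reindexing by the values themselves leaves at most the term
      \<open>y = f x\<close>; it is absent exactly when \<open>f x = 0\<close>, and the sum is then
      0 as well.\<close>
    have "(\<Sum>k<card V. c k * indicator (A k) x) = (\<Sum>y\<in>c ` {..<card V}. y * indicator {f x} y)"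
      unfolding sum.reindex[OF inj]
      by (rule sum.cong) (use that in \<open>auto simp: A_def indicator_def\<close>)
    also have "\<dots> = (\<Sum>y\<in>V. y * indicator {f x} y)"
      by (simp only: img)
    also have "\<dots> = f x"
    proof (cases "f x = 0")
      case True
      then show ?thesis by (auto intro!: sum.neutral simp: V_def indicator_def)
    next
      case False
      with that have "f x \<in> V" by (auto simp: V_def)
      then have "(\<Sum>y\<in>V. y * indicator {f x} y) = (\<Sum>y\<in>{f x}. y * indicator {f x} y)"
        using \<open>finite V\<close> by (intro sum.mono_neutral_right) (auto simp: indicator_def)
      then show ?thesis by simp
    qed
    finally show ?thesis by simp
  qed
  ultimately show ?thesis
    unfolding has_simple_integral_def by blast
qed

lemma L2_approximates_exists:
  assumes f: "f \<in> L2_space S"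
  shows "\<exists>fs Ys. approximates S W f fs Ys"
proof -
  note [measurable] = L2_space_measurable[OF f]
  note int = L2_space_integrable[OF f]
  \<comment> \<open>With base point 0 the simple functions converge pointwise and satisfy
    \<open>\<bar>fs i x\<bar> \<le> 2 * \<bar>f x\<bar>\<close>, which makes them square-integrable
    and prepares dominated convergence.\<close>
  from borel_measurable_implies_sequence_metric[OF L2_space_measurable[OF f], of 0]
  obtain fs where fs: "\<And>i. simple_function S (fs i)"
    and lim: "\<And>x. x \<in> space S \<Longrightarrow> (\<lambda>i. fs i x) \<longlonglongrightarrow> f x"
    and bound: "\<And>i x. x \<in> space S \<Longrightarrow> \<bar>fs i x\<bar> \<le> 2 * \<bar>f x\<bar>"
    by (simp add: dist_real_def) metis
  have [measurable]: "fs i \<in> borel_measurable S" for i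
    using fs by (rule borel_measurable_simple_function)
  have sq: "(fs i x)\<^sup>2 \<le> 4 * (f x)\<^sup>2" if "x \<in> space S" for i x
    using power_mono[OF bound[OF that], where n = 2] by (simp add: power_mult_distrib)
  have fs_int: "integrable S (\<lambda>x. (fs i x)\<^sup>2)" for i
    by (rule Bochner_Integration.integrable_bound[of S "\<lambda>x. 4 * (f x)\<^sup>2"]) (use int sq in auto)
  then have fs_L2: "fs i \<in> L2_space S" for i
    by (simp add: L2_space_iff)
  have "(\<lambda>i. \<integral>x. (fs i x - f x)\<^sup>2 \<partial>S) \<longlonglongrightarrow> (\<integral>x. 0 \<partial>S)"
  \<comment> \<open>The constant 9 is the square of 3, from \<open>\<bar>fs i x - f x\<bar> \<le> 2
    * \<bar>f x\<bar> + \<bar>f x\<bar>\<close>.\<close>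
  proof (rule integral_dominated_convergence[where w = "\<lambda>x. 9 * (f x)\<^sup>2"])
    show "AE x in S. (\<lambda>i. (fs i x - f x)\<^sup>2) \<longlonglongrightarrow> 0"
    proof (rule AE_I2)
      fix x assume "x \<in> space S"
      then show "(\<lambda>i. (fs i x - f x)\<^sup>2) \<longlonglongrightarrow> 0"
        using tendsto_power[OF LIM_zero[OF lim], of x 2] by simp
    qed
    show "AE x in S. norm ((fs i x - f x)\<^sup>2) \<le> 9 * (f x)\<^sup>2" for i
    proof (rule AE_I2)
      fix x assume "x \<in> space S"
      then have "\<bar>fs i x - f x\<bar> \<le> 3 * \<bar>f x\<bar>"
        using bound[of x i] by linarith
      from power_mono[OF this, of 2] show "norm ((fs i x - f x)\<^sup>2) \<le> 9 * (f x)\<^sup>2"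
        by (simp add: power_mult_distrib)
    qed
  qed (use int in auto)
  then have "(\<lambda>i. L2_norm S (\<lambda>x. fs i x - f x)) \<longlonglongrightarrow> 0"
    unfolding L2_norm_def power2_abs using tendsto_real_sqrt by fastforce
  then have "L2_tendsto S fs f"
    using f fs_L2 by (simp add: L2_tendsto_def)
  moreover have "\<exists>Ys. \<forall>i. has_simple_integral S W (fs i) (Ys i)"
    by (intro choice allI simple_function_has_simple_integral fs fs_int)
  ultimately show ?thesis
    by (auto simp: approximates_def)
qed

section \<open>Extension by isometry\<close>

text \<open>By the isometry the distance of the integrals is that of \<open>gs n\<close> and
  \<open>fs n\<close>, which the triangle inequality through \<open>f\<close> sends to 0.\<close>

lemma approximates_diff_norm_tendsto:
  assumes P: "prob_space P" and W: "gaussian_process S P W"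
    and "approximates S W f fs Ys" "approximates S W f gs Zs"
  shows "(\<lambda>n. L2_norm P (\<lambda>\<omega>. Zs n \<omega> - Ys n \<omega>)) \<longlonglongrightarrow> 0"
proof -
  have fs: "\<And>n. has_simple_integral S W (fs n) (Ys n)" "\<And>n. fs n \<in> L2_space S"
      "(\<lambda>n. L2_norm S (\<lambda>x. fs n x - f x)) \<longlonglongrightarrow> 0"
    and gs: "\<And>n. has_simple_integral S W (gs n) (Zs n)" "\<And>n. gs n \<in> L2_space S"
      "(\<lambda>n. L2_norm S (\<lambda>x. gs n x - f x)) \<longlonglongrightarrow> 0"
    and f: "f \<in> L2_space S"
    using assms by (auto simp: approximates_def L2_tendsto_def)
  show ?thesis
  proof (rule tendsto_sandwich[OF _ _ tendsto_const])
    show "(\<lambda>n. L2_norm S (\<lambda>x. gs n x - f x) + L2_norm S (\<lambda>x. fs n x - f x)) \<longlonglongrightarrow> 0"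
      using tendsto_add[OF gs(3) fs(3)] by simp
    show "\<forall>\<^sub>F n in sequentially. L2_norm P (\<lambda>\<omega>. Zs n \<omega> - Ys n \<omega>)
        \<le> L2_norm S (\<lambda>x. gs n x - f x) + L2_norm S (\<lambda>x. fs n x - f x)"
    proof (rule always_eventually, rule allI)
      fix n
      show "L2_norm P (\<lambda>\<omega>. Zs n \<omega> - Ys n \<omega>)
          \<le> L2_norm S (\<lambda>x. gs n x - f x) + L2_norm S (\<lambda>x. fs n x - f x)"
        using L2_norm_diff_triangle[OF gs(2) f fs(2), of n n]
        by (simp add: has_simple_integral_isometry[OF P W gs(1) fs(1)] L2_norm_minus_commute[of S f])
    qed
  qed simp
qed

text \<open>A convergent sequence is Cauchy, the isometry transports this to the integrals, and
  completeness of \<open>L2_space P\<close> supplies the limit.\<close>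

lemma approximates_L2_converges:
  assumes P: "prob_space P" and W: "gaussian_process S P W" and "approximates S W f fs Ys"
  shows "\<exists>X. L2_tendsto P Ys X"
proof (rule L2_complete)
  have fs: "\<And>n. has_simple_integral S W (fs n) (Ys n)" "\<And>n. fs n \<in> L2_space S"
      "(\<lambda>n. L2_norm S (\<lambda>x. fs n x - f x)) \<longlonglongrightarrow> 0" and f: "f \<in> L2_space S"
    using assms by (auto simp: approximates_def L2_tendsto_def)
  show "Ys n \<in> L2_space P" for n
    using has_simple_integral_L2[OF P W fs(1)] by simp
  fix e :: real assume "0 < e"
  then obtain N where N: "\<And>n. N \<le> n \<Longrightarrow> L2_norm S (\<lambda>x. fs n x - f x) < e / 2"
    using LIMSEQ_D[OF fs(3), of "e / 2"] by auto
  have "L2_norm P (\<lambda>\<omega>. Ys m \<omega> - Ys n \<omega>) < e" if "N \<le> m" "N \<le> n" for m n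
    using L2_norm_diff_triangle[OF fs(2) f fs(2), of m n] N[OF that(1)] N[OF that(2)]
    by (simp add: has_simple_integral_isometry[OF P W fs(1) fs(1)] L2_norm_minus_commute[of S f])
  then show "\<exists>N. \<forall>m\<ge>N. \<forall>n\<ge>N. L2_norm P (\<lambda>\<omega>. Ys m \<omega> - Ys n \<omega>) < e" by blast
qed

theorem lemma3p5:
  fixes S :: "'a measure" and P :: "'b measure"
    and W :: "'a set \<Rightarrow> 'b \<Rightarrow> real"
  assumes "sigma_finite_measure S"
    and "prob_space P"
    and "gaussian_process S P W"
  shows "\<forall>f\<in>L2_space S.
      (\<exists>X\<in>L2_space P. has_gaussian_integral S P W f X) \<and>
      (\<forall>X Y. has_gaussian_integral S P W f X \<and> has_gaussian_integral S P W f Y \<longrightarrow>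
         (AE \<omega> in P. X \<omega> = Y \<omega>)) \<and>
      (\<forall>X. has_gaussian_integral S P W f X \<longrightarrow>
         (\<integral>\<omega>. \<bar>X \<omega>\<bar>\<^sup>2 \<partial>P) = (\<integral>x. \<bar>f x\<bar>\<^sup>2 \<partial>S))"
proof (intro ballI conjI allI impI)
  note P = assms(2) and W = assms(3)
  fix f assume "f \<in> L2_space S"
  \<comment> \<open>One fixed approximating sequence serves all three claims: its limit is the
    candidate integral, any two versions of the integral are limits of the same \<open>Ys\<close>,
    and the norm identity is passed to the limit along it.\<close>
  then obtain fs Ys where approx: "approximates S W f fs Ys"
    using L2_approximates_exists by blast
  show "\<exists>X\<in>L2_space P. has_gaussian_integral S P W f X"
  proof -
    obtain X where X: "L2_tendsto P Ys X"
      using approximates_L2_converges[OF P W approx] by blast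
    have "L2_tendsto P Zs X" if Z: "approximates S W f gs Zs" for gs Zs
    proof (rule L2_tendsto_if_diff_tendsto_0[OF X _ approximates_diff_norm_tendsto[OF P W approx Z]])
      show "Zs n \<in> L2_space P" for n
        using Z has_simple_integral_L2(2)[OF P W, of "gs n" "Zs n"] by (simp add: approximates_def)
    qed
    with approx have "has_gaussian_integral S P W f X"
      by (auto simp: has_gaussian_integral_def)
    moreover have "X \<in> L2_space P"
      using X by (simp add: L2_tendsto_def)
    ultimately show ?thesis by blast
  qed
  show "AE \<omega> in P. X \<omega> = Y \<omega>"
    if "has_gaussian_integral S P W f X \<and> has_gaussian_integral S P W f Y" for X Y
    using that approx by (intro L2_tendsto_unique[of P Ys]) (auto simp: has_gaussian_integral_def)
  show "(\<integral>\<omega>. \<bar>X \<omega>\<bar>\<^sup>2 \<partial>P) = (\<integral>x. \<bar>f x\<bar>\<^sup>2 \<partial>S)" if "has_gaussian_integral S P W f X" for X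
  proof -
    \<comment> \<open>The inner product identity with both arguments equal.\<close>
    have "L2_norm P (Ys n) = L2_norm S (fs n)" for n
      using approx has_simple_integral_inner[OF P W, of "fs n" "Ys n" "fs n" "Ys n"]
      by (simp add: approximates_def L2_norm_def power2_eq_square)
    moreover have "(\<lambda>n. L2_norm P (Ys n)) \<longlonglongrightarrow> L2_norm P X"
      using that approx by (intro L2_tendsto_norm) (auto simp: has_gaussian_integral_def)
    moreover have "(\<lambda>n. L2_norm S (fs n)) \<longlonglongrightarrow> L2_norm S f"
      using approx by (intro L2_tendsto_norm) (simp add: approximates_def)
    ultimately have "L2_norm P X = L2_norm S f"
      using LIMSEQ_unique by simp
    then show ?thesis
      by (simp add: L2_norm_def)
  qed
qed

end
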